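(* Let $f:\mathbb{R}_+\times\mathbb{R}^n\to\mathbb{R}^n$ be continuously differentiable, let $t_0>0$, and consider the system $\dot x=f(t,x)$, $x(t_0)=x_0$, with solution $\psi(t)=\psi(t,x_0)$, and its variational system along $\psi$, $$\delta\dot x=h(\delta x,\psi(t,x_0),t),\qquad h(\delta x,x,t)=\frac{\partial f}{\partial x}(t,x)\,\delta x,$$ with solution $\delta\psi(t)=\delta\psi(t,x_0,\delta x_0)$ on $t\ge t_0$ starting from $\delta x_0$ at $t_0$. Let $\phi\in C[\mathbb{R}_+\times\mathbb{R}^n\times\mathbb{R}^n,\mathbb{R}^n]$, $(t,u,x)\mapsto\phi(t,u,x)$, be quasi-monotone non-decreasing in $u\in\mathbb{R}^n$. Let $A=(a_{ij})_{n\times n}$ be a nonzero matrix with $a_{ij}\ge0$ for all $i,j$, and suppose that for any solution $\delta\psi(t,x_0,\delta x_0)$ of the variational system on $t\ge t_0$, $$2A\big(\delta\psi(t)\circ h(\delta\psi(t),\psi(t),t)\big)<\phi\big(t,\,A(\delta\psi(t)\circ\delta\psi(t)),\,\psi(t)\big)\quad\text{for all }t\ge t_0.$$ Let $R(t)=R(t,u_0,x_0)$, $t\ge t_0$, be a maximal solution of $$\dot u=\phi(t,u,\psi(t,x_0)),\qquad u(t_0)=u_0\ge0.$$ Then any solution $\delta\psi(t)=\delta\psi(t,x_0,\delta x_0)$ of the variational system on $t\ge t_0$ with $A(\delta x_0\circ\delta x_0)<u_0$ has the property that $$A(\delta\psi(t)\circ\delta\psi(t))<R(t)\quad\text{for all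 }t\ge t_0.$$
   Context: Standing assumption: $\dot x=f(t,x)$, $x(t_0)=x_0$ has a unique solution $\psi(t,x_0)$ for each initial state $x_0$. For $x,y\in\mathbb{R}^n$: $x\le y$ means $x_i\le y_i$ for all $i$; $x<y$ means $x_i<y_i$ for all $i$; $x\circ y=(x_1y_1,\dots,x_ny_n)^T$ is the componentwise product (the paper writes $\mathrm{dvec}(\mathrm{diag}(x)\,\mathrm{diag}(y))$). $C[X,Y]$ is the set of continuous functions from $X$ to $Y$; $\mathbb{R}_+=[0,\infty)$. A continuous function $G=(G_1,\dots,G_n)$ on a nonempty subset of $\mathbb{R}^n$ is quasi-monotone non-decreasing if for each $i$, $G_i$ is nondecreasing in $u_j$ for all $j\ne i$. A solution $R(t)$ of an initial value problem is called a maximal solution if every solution $u(t)$ of that problem satisfies $u(t)\le R(t)$ for all $t\ge t_0$. *)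

theory Defs
  imports "HOL-Analysis.Analysis"
begin

text \<open>
  On \<^typ>\<open>real^'n\<close> the library's \<open>*\<close> is the componentwise product and \<open>\<le>\<close> the componentwise order,
  but its \<open><\<close> only means \<open>\<le>\<close> and \<open>\<noteq>\<close>. The order that is strict in every component is
  \<^const>\<open>eucl_less\<close>.
\<close>

notation eucl_less (infix \<open><e\<close> 50)

lemma eucl_less_vec_iff: "x <e y \<longleftrightarrow> (\<forall>i. x $ i < y $ i)" for x y :: "real^'n"
  by (auto simp: eucl_less_def Basis_vec_def inner_axis)

text \<open>The derivative is taken within \<open>S\<close>, hence one-sided at boundary points of \<open>S\<close>.\<close>

definition continuously_differentiable_on ::
    "('a::real_normed_vector \<Rightarrow> 'b::real_normed_vector) \<Rightarrow> 'a set \<Rightarrow> bool" where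
  "continuously_differentiable_on f S \<longleftrightarrow>
     (\<exists>f' :: 'a \<Rightarrow> 'a \<Rightarrow>\<^sub>L 'b.
        (\<forall>p\<in>S. (f has_derivative blinfun_apply (f' p)) (at p within S)) \<and> continuous_on S f')"

text \<open>Solutions live on the whole half-line \<open>{t0..}\<close>; their values before \<open>t0\<close> are irrelevant.\<close>

definition solves_ivp ::
    "(real \<Rightarrow> 'a::real_normed_vector \<Rightarrow> 'a) \<Rightarrow> real \<Rightarrow> 'a \<Rightarrow> (real \<Rightarrow> 'a) \<Rightarrow> bool" where
  "solves_ivp F t0 x0 x \<longleftrightarrow>
     x t0 = x0 \<and> (\<forall>t\<ge>t0. (x has_vector_derivative F t (x t)) (at t within {t0..}))"

definition unique_solution ::
    "(real \<Rightarrow> 'a::real_normed_vector \<Rightarrow> 'a) \<Rightarrow> real \<Rightarrow> 'a \<Rightarrow> (real \<Rightarrow> 'a) \<Rightarrow> bool" where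
  "unique_solution F t0 x0 x \<longleftrightarrow>
     solves_ivp F t0 x0 x \<and> (\<forall>y. solves_ivp F t0 x0 y \<longrightarrow> (\<forall>t\<ge>t0. y t = x t))"

definition maximal_solution ::
    "(real \<Rightarrow> real^'n \<Rightarrow> real^'n) \<Rightarrow> real \<Rightarrow> real^'n \<Rightarrow> (real \<Rightarrow> real^'n) \<Rightarrow> bool" where
  "maximal_solution F t0 u0 R \<longleftrightarrow>
     solves_ivp F t0 u0 R \<and> (\<forall>u. solves_ivp F t0 u0 u \<longrightarrow> (\<forall>t\<ge>t0. u t \<le> R t))"

definition quasi_monotone_on :: "(real^'n) set \<Rightarrow> (real^'n \<Rightarrow> real^'n) \<Rightarrow> bool" where
  "quasi_monotone_on D G \<longleftrightarrow>
     (\<forall>i j. j \<noteq> i \<longrightarrow>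
        (\<forall>u\<in>D. \<forall>v\<in>D. (\<forall>k. k \<noteq> j \<longrightarrow> u $ k = v $ k) \<and> u $ j \<le> v $ j \<longrightarrow> G u $ i \<le> G v $ i))"

definition variational_field ::
    "(real \<Rightarrow> real^'n \<Rightarrow> real^'n) \<Rightarrow> real^'n \<Rightarrow> real^'n \<Rightarrow> real \<Rightarrow> real^'n" where
  "variational_field f \<delta>x x t = jacobian (f t) (at x) *v \<delta>x"

end

theory Submission
  imports Defs
begin

text \<open>
  Put \<open>m = A(\<delta>\<psi> \<circ> \<delta>\<psi>)\<close>, so that \<open>m' = 2 A(\<delta>\<psi> \<circ> h) < \<phi>(t, m, \<psi>)\<close> while \<open>R' = \<phi>(t, R, \<psi>)\<close>. At the first
  time \<open>s > t0\<close> at which some component \<open>m\<^sub>i\<close> meets \<open>R\<^sub>i\<close> we have \<open>m \<le> R\<close>, so quasi-monotonicity gives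
  \<open>m\<^sub>i' < R\<^sub>i'\<close> at \<open>s\<close>; then \<open>m\<^sub>i > R\<^sub>i\<close> just before \<open>s\<close>, a contradiction.
\<close>

text \<open>The definition of \<open>quasi_monotone_on\<close> moves a single coordinate; the
  passage from \<open>u\<close> to \<open>v\<close> is therefore a chain that raises the coordinates
  one after another.\<close>

lemma quasi_monotone_on_le:
  fixes u v :: "real^'n"
  assumes G: "quasi_monotone_on UNIV G" and le: "u \<le> v" and eq: "u $ i = v $ i"
  shows "G u $ i \<le> G v $ i"
proof -
  define w where "w J = (\<chi> k. if k \<in> J then v $ k else u $ k)" for J :: "'n set"
  have "G u $ i \<le> G (w J) $ i" if "finite J" for J
    using that
  proof induction
    case empty
    have "w {} = u" by (simp add: w_def vec_eq_iff)
    then show ?case by simp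
  next
    case (insert j J)
    have "G (w J) $ i \<le> G (w (insert j J)) $ i"
    \<comment> \<open>Quasi-monotonicity says nothing about raising coordinate \<open>i\<close>
      itself, but there \<open>u\<close> and \<open>v\<close> agree, so this link of the chain is
      trivial.\<close>
    proof (cases "j = i")
      case True
      then have "w (insert j J) = w J" using eq by (simp add: w_def vec_eq_iff)
      then show ?thesis by simp
    next
      case False
      have "\<forall>k. k \<noteq> j \<longrightarrow> w J $ k = w (insert j J) $ k" by (simp add: w_def)
      moreover have "w J $ j \<le> w (insert j J) $ j" using le by (simp add: w_def less_eq_vec_def)
      ultimately show ?thesis
        using G False unfolding quasi_monotone_on_def by blast
    qed
    with insert.IH show ?case by linarith
  qed
  then have "G u $ i \<le> G (w UNIV) $ i" by simp
  moreover have "w UNIV = v" by (simp add: w_def vec_eq_iff)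
  ultimately show ?thesis by simp
qed

text \<open>The open positive orthant traps a curve whose velocity points strictly inward through
  every face it touches. No differential equation enters, so the result can be applied to the
  difference of two curves.\<close>

lemma components_stay_positive:
  fixes d d' :: "real \<Rightarrow> real^'n"
  assumes deriv: "\<And>t. t \<ge> t0 \<Longrightarrow> (d has_vector_derivative d' t) (at t within {t0..})"
    and init: "\<And>i. d t0 $ i > 0"
    and inward: "\<And>t i. t > t0 \<Longrightarrow> (\<And>j. d t $ j \<ge> 0) \<Longrightarrow> d t $ i = 0 \<Longrightarrow> d' t $ i > 0"
    and T: "T \<ge> t0"
  shows "d T $ i > 0"
proof (rule ccontr)
  assume notpos: "\<not> d T $ i > 0"
  have dc: "((\<lambda>t. d t $ j) has_real_derivative d' t $ j) (at t within {t0..})" if "t \<ge> t0" for t j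
    using bounded_linear.has_vector_derivative[OF bounded_linear_vec_nth deriv[OF that]]
    by (simp add: has_real_derivative_iff_has_vector_derivative)
  have cont: "continuous_on {t0..} (\<lambda>t. d t $ j)" for j
    using dc by (intro DERIV_continuous_on) auto
  \<comment> \<open>A finite union of closed sets of times, containing \<open>T\<close>; its infimum
    is attained and is the first time at which positivity fails.\<close>
  define S where "S = (\<Union>j. {t \<in> {t0..T}. d t $ j \<le> 0})"
  have "closed S"
    unfolding S_def
    by (intro closed_UN ballI finite continuous_on_closed_Collect_le closed_atLeastAtMost
        continuous_on_const continuous_on_subset[OF cont]) auto
  moreover have "S \<noteq> {}" and bdd: "bdd_below S"
    using notpos T by (auto simp: S_def not_less intro!: bdd_belowI[of _ t0])
  ultimately have InfS: "Inf S \<in> S" by (rule closed_contains_Inf[rotated -1])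
  define s where "s = Inf S"
  obtain k where k: "d s $ k \<le> 0" and s: "t0 \<le> s" "s \<le> T"
    using InfS by (auto simp: S_def s_def)
  have "s \<noteq> t0" using k init[of k] by auto
  with s have "t0 < s" by simp
  have before: "d r $ j > 0" if "t0 \<le> r" "r < s" for r j
    using that s cInf_lower[OF _ bdd, of r] by (fastforce simp: S_def s_def not_less[symmetric])
  \<comment> \<open>\<open>inward\<close> needs all components at \<open>s\<close>, not only the
    \<open>k\<close>-th. A negative one would have vanished at some earlier time by the intermediate
    value theorem.\<close>
  have nonneg: "d s $ j \<ge> 0" for j
  proof (rule ccontr)
    assume "\<not> d s $ j \<ge> 0"
    moreover have "continuous_on {t0..s} (\<lambda>t. d t $ j)"
      by (rule continuous_on_subset[OF cont]) auto
    ultimately obtain r where "t0 \<le> r" "r \<le> s" "d r $ j = 0"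
      using IVT2'[of "\<lambda>t. d t $ j" s 0 t0] init[of j] s by auto
    then show False
      using before[of r j] \<open>\<not> d s $ j \<ge> 0\<close> by (cases "r = s") auto
  qed
  then have zero: "d s $ k = 0" using k by (simp add: order_antisym)
  have "d' s $ k > 0" using inward[OF \<open>t0 < s\<close> nonneg zero] .
  from has_real_derivative_pos_inc_left[OF dc[OF s(1)] this]
  obtain e where e: "e > 0"
    "\<And>h. h > 0 \<Longrightarrow> s - h \<in> {t0..} \<Longrightarrow> h < e \<Longrightarrow> d (s - h) $ k < d s $ k" by blast
  \<comment> \<open>Halving \<open>e\<close> keeps \<open>h\<close> strictly below \<open>e\<close>;
    the bound \<open>s - t0\<close> keeps \<open>s - h\<close> in the domain, with \<open>t0\<close>
    itself allowed. There component \<open>k\<close> would already be negative, before the first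
    failure.\<close>
  define h where "h = min (e / 2) (s - t0)"
  have "h > 0" "h < e" "t0 \<le> s - h" using e(1) \<open>t0 < s\<close> by (auto simp: h_def)
  then show False
    using e(2)[of h] before[of "s - h" k] zero by auto
qed

text \<open>This is \<open>components_stay_positive\<close> for \<open>R - m\<close>: on a face,
  quasi-monotonicity compares the values of \<open>F\<close>, and \<open>sub\<close> makes the
  inequality strict.\<close>

lemma strict_comparison:
  fixes m R :: "real \<Rightarrow> real^'n"
  assumes m: "\<And>t. t \<ge> t0 \<Longrightarrow> (m has_vector_derivative m' t) (at t within {t0..})"
    and sub: "\<And>t. t \<ge> t0 \<Longrightarrow> m' t <e F t (m t)"
    and R: "solves_ivp F t0 u0 R"
    and init: "m t0 <e u0"
    and qmono: "\<And>t. t \<ge> t0 \<Longrightarrow> quasi_monotone_on UNIV (F t)"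
    and t: "t \<ge> t0"
  shows "m t <e R t"
proof -
  have "(R t - m t) $ i > 0" for i
  proof (rule components_stay_positive[where d' = "\<lambda>t. F t (R t) - m' t"])
    fix t assume "t \<ge> t0"
    then show "((\<lambda>t. R t - m t) has_vector_derivative F t (R t) - m' t) (at t within {t0..})"
      using R m unfolding solves_ivp_def by (intro has_vector_derivative_diff) auto
  next
    show "(R t0 - m t0) $ i > 0" for i
      using R init by (simp add: solves_ivp_def eucl_less_vec_iff)
  next
    fix t i assume *: "t > t0" "\<And>j. (R t - m t) $ j \<ge> 0" "(R t - m t) $ i = 0"
    have "F t (m t) $ i \<le> F t (R t) $ i"
      using * by (intro quasi_monotone_on_le qmono) (auto simp: less_eq_vec_def)
    moreover have "m' t $ i < F t (m t) $ i"
      using sub[of t] * by (simp add: eucl_less_vec_iff)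
    ultimately show "(F t (R t) - m' t) $ i > 0" by simp
  qed (rule t)
  then show ?thesis by (simp add: eucl_less_vec_iff)
qed

text \<open>The product rule in each coordinate, followed by the constant linear map
  \<open>A\<close>.\<close>

lemma has_vector_derivative_matrix_square:
  fixes A :: "real^'n^'m" and x :: "real \<Rightarrow> real^'n"
  assumes "(x has_vector_derivative x') (at t within S)"
  shows "((\<lambda>t. A *v (x t * x t)) has_vector_derivative 2 *\<^sub>R (A *v (x t * x'))) (at t within S)"
proof -
  have x: "((\<lambda>t. x t $ j) has_real_derivative x' $ j) (at t within S)" for j
    using bounded_linear.has_vector_derivative[OF bounded_linear_vec_nth assms]
    by (simp add: has_real_derivative_iff_has_vector_derivative)
  have "((\<lambda>t. x t * x t) has_vector_derivative (\<chi> j. 2 * (x t $ j * x' $ j))) (at t within S)"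
    \<comment> \<open>Inner products with the standard basis reduce the claim to scalar
      squares.\<close>
    unfolding has_vector_derivative_def has_derivative_componentwise_within[of "\<lambda>t. x t * x t"]
    using x
    by (auto simp: Basis_vec_def inner_axis has_field_derivative_def intro!: derivative_eq_intros)
  from bounded_linear.has_vector_derivative[OF matrix_vector_mul_bounded_linear[of A] this]
  moreover have "A *v (\<chi> j. 2 * (x t $ j * x' $ j)) = 2 *\<^sub>R (A *v (x t * x'))"
    by (simp add: matrix_vector_mult_def vec_eq_iff sum_distrib_left mult_ac)
  ultimately show ?thesis by simp
qed

theorem corollary1:
  fixes f :: "real \<Rightarrow> real^'n \<Rightarrow> real^'n"
    and \<psi> :: "real \<Rightarrow> real^'n \<Rightarrow> real^'n"
    and \<phi> :: "real \<Rightarrow> real^'n \<Rightarrow> real^'n \<Rightarrow> real^'n"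
    and A :: "real^'n^'n"
    and t0 :: real
    and x0 u0 :: "real^'n"
    and R :: "real \<Rightarrow> real^'n"
  defines "h \<equiv> variational_field f"
  assumes f_C1: "continuously_differentiable_on (\<lambda>(t, x). f t x) ({0..} \<times> UNIV)"
    and t0_pos: "t0 > 0"
    and flow: "\<And>y0. unique_solution f t0 y0 (\<lambda>t. \<psi> t y0)"
    and \<phi>_cont: "continuous_on ({0..} \<times> UNIV \<times> UNIV) (\<lambda>(t, u, x). \<phi> t u x)"
    and \<phi>_qmono: "\<And>t x. t \<ge> 0 \<Longrightarrow> quasi_monotone_on UNIV (\<lambda>u. \<phi> t u x)"
    and A_nonzero: "A \<noteq> 0"
    and A_nonneg: "\<And>i j. A $ i $ j \<ge> 0"
    and ineq: "\<And>\<delta>x0 \<delta>\<psi> t.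
      solves_ivp (\<lambda>s \<delta>x. h \<delta>x (\<psi> s x0) s) t0 \<delta>x0 \<delta>\<psi> \<Longrightarrow> t \<ge> t0 \<Longrightarrow>
        2 *\<^sub>R (A *v (\<delta>\<psi> t * h (\<delta>\<psi> t) (\<psi> t x0) t)) <e \<phi> t (A *v (\<delta>\<psi> t * \<delta>\<psi> t)) (\<psi> t x0)"
    and u0_nonneg: "u0 \<ge> 0"
    and R_max: "maximal_solution (\<lambda>t u. \<phi> t u (\<psi> t x0)) t0 u0 R"
  shows "\<forall>\<delta>x0 \<delta>\<psi>.
      solves_ivp (\<lambda>s \<delta>x. h \<delta>x (\<psi> s x0) s) t0 \<delta>x0 \<delta>\<psi> \<longrightarrow>
      A *v (\<delta>x0 * \<delta>x0) <e u0 \<longrightarrow>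
      (\<forall>t\<ge>t0. A *v (\<delta>\<psi> t * \<delta>\<psi> t) <e R t)"
proof (intro allI impI)
  fix \<delta>x0 \<delta>\<psi> t
  assume sol: "solves_ivp (\<lambda>s \<delta>x. h \<delta>x (\<psi> s x0) s) t0 \<delta>x0 \<delta>\<psi>"
    and init: "A *v (\<delta>x0 * \<delta>x0) <e u0" and t: "t0 \<le> t"
  show "A *v (\<delta>\<psi> t * \<delta>\<psi> t) <e R t"
  \<comment> \<open>Since \<delta>\<psi> has velocity \<open>h\<close>, the product rule yields this
    \<open>m'\<close>, and \<open>ineq\<close> is then the required strict differential
    inequality.\<close>
  proof (rule strict_comparison[where m = "\<lambda>t. A *v (\<delta>\<psi> t * \<delta>\<psi> t)"
        and m' = "\<lambda>t. 2 *\<^sub>R (A *v (\<delta>\<psi> t * h (\<delta>\<psi> t) (\<psi> t x0) t))"])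
    show "solves_ivp (\<lambda>t u. \<phi> t u (\<psi> t x0)) t0 u0 R"
      using R_max by (simp add: maximal_solution_def)
    show "A *v (\<delta>\<psi> t0 * \<delta>\<psi> t0) <e u0"
      using sol init by (simp add: solves_ivp_def)
  next
    fix s assume s: "s \<ge> t0"
    show "((\<lambda>t. A *v (\<delta>\<psi> t * \<delta>\<psi> t)) has_vector_derivative
        2 *\<^sub>R (A *v (\<delta>\<psi> s * h (\<delta>\<psi> s) (\<psi> s x0) s))) (at s within {t0..})"
      using sol s by (intro has_vector_derivative_matrix_square) (simp add: solves_ivp_def)
    show "2 *\<^sub>R (A *v (\<delta>\<psi> s * h (\<delta>\<psi> s) (\<psi> s x0) s)) <e \<phi> s (A *v (\<delta>\<psi> s * \<delta>\<psi> s)) (\<psi> s x0)"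
      using ineq[OF sol s] .
    show "quasi_monotone_on UNIV (\<lambda>u. \<phi> s u (\<psi> s x0))"
      using s t0_pos by (intro \<phi>_qmono) simp
  qed (rule t)
qed

end
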